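(* Let $H$ be a real Hilbert space, $z_0\in H$, and let $\Phi:H\times[0,\infty)\to H$ be such that $\Phi(h,t)$ is Fréchet differentiable with respect to $h$. Suppose there exist a differentiable function $x:[0,+\infty)\to H$, a continuous function $\alpha:[0,\infty)\to[0,\infty)$ and continuous functions $\gamma,\sigma:[0,\infty)\to\mathbb R$ such that for all $h\in H$ and $t\in[0,+\infty)$ $$(\Phi(h,t),h-x(t))\le \alpha(t)\|h-x(t)\|-\gamma(t)\|h-x(t)\|^2+\sigma(t)\|h-x(t)\|^3 .$$ Put $\beta(t):=\|\dot x(t)\|+\alpha(t)$, and assume $\beta$ is continuous on $[0,\infty)$. Suppose there is a positive function $\mu\in C^1[0,\infty)$ with $\mu(t)\to+\infty$ as $t\to+\infty$ such that for all $t\ge0$ $$0\le\sigma(t)\le\frac{\mu(t)}{2}\left(\gamma(t)-\frac{\dot\mu(t)}{\mu(t)}\right),\qquad \beta(t)\le\frac{1}{2\mu(t)}\left(\gamma(t)-\frac{\dot\mu(t)}{\mu(t)}\right),$$ and $\mu(0)\|z_0-x(0)\|<1$. Then the Cauchy problem $$\dot z(t)=\Phi(z(t),t),\qquad z(0)=z_0,$$ has a unique solution $z(t)$ defined for all $t\in[0,\infty)$, and $$\|z(t)-x(t)\|<\frac1{\mu(t)}\ \ (t\ge 0),\qquad \lim_{t\to+\infty}\|z(t)-x(t)\|=0.$$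
   Context: $(\cdot,\cdot)$ and $\|\cdot\|$ are the inner product and norm of $H$; a dot denotes the (strong) derivative with respect to $t$.
   Formalization: Added assumptions: Φ(h,t) is continuous in t on [0,∞) for each h, and its Fréchet derivative in h is bounded on {‖h‖≤R}×[0,T] for all R,T; with Fréchet differentiability in h alone, existence and uniqueness can fail. *)

theory Defs
  imports "HOL-Analysis.Analysis"
begin

text \<open>
  Time derivatives are taken within \<open>{0..}\<close>: one-sided at \<open>t = 0\<close>, two-sided at \<open>t > 0\<close>.
  Values of \<open>z\<close> at negative times are irrelevant.
\<close>

definition solves_cauchy ::
    "('a::real_normed_vector \<Rightarrow> real \<Rightarrow> 'a) \<Rightarrow> 'a \<Rightarrow> (real \<Rightarrow> 'a) \<Rightarrow> bool" where
  "solves_cauchy \<Phi> z\<^sub>0 z \<longleftrightarrow>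
     z 0 = z\<^sub>0 \<and> (\<forall>t\<ge>0. (z has_vector_derivative \<Phi> (z t) t) (at t within {0..}))"

text \<open>
  Pitfall: pointwise Frechet differentiability of \<open>\<Phi>\<close> in \<open>h\<close> alone does not make the Cauchy problem
  \<open>z' = \<Phi> z t\<close> well posed, even under a one-sided growth estimate. A jump of \<open>\<Phi>\<close> in \<open>t\<close> destroys
  existence, an unbounded derivative in \<open>h\<close> destroys uniqueness, and in infinite dimension a
  bounded local solution need not extend. Hence continuity of \<open>\<Phi>\<close> in \<open>t\<close>, and boundedness of its
  \<open>h\<close>-derivative on bounded subsets of \<open>H \<times> [0, \<infinity>)\<close>, are stated as hypotheses of their own.
\<close>

end

theory Submission
  imports Defs
begin

text \<open>
  Put \<open>v = \<mu> \<parallel>z - x\<parallel>\<close> and \<open>A = \<gamma> - \<mu>' / \<mu> \<ge> 0\<close>. The hypotheses on \<open>\<beta>\<close> and \<open>\<sigma>\<close> are exactly what turns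
  the estimate for \<open>\<Phi>\<close> into \<open>v' \<le> A (1 - v)\<^sup>2 / 2\<close>, whose right-hand side vanishes to second order at
  \<open>v = 1\<close>, so that \<open>v < 1\<close> persists. Working with \<open>q = v\<^sup>2\<close>, which is differentiable even where
  \<open>z = x\<close>, one gets \<open>q' \<le> A (1 - q)\<close> as long as \<open>q < 1\<close>, and Gronwall's inequality up to the first
  time with \<open>q \<ge> 1\<close> gives a contradiction. Since this a priori bound confines \<open>z t\<close> to the ball of
  radius \<open>1 / \<mu> t\<close> around \<open>x t\<close>, one may replace \<open>\<Phi>\<close> by its composition with the radial retraction
  onto that ball. The new right-hand side is Lipschitz in \<open>h\<close> uniformly on compact time intervals,
  so Picard iteration gives a global solution, which by the bound solves the original problem.
\<close>

section \<open>Calculus on the half-line and a Gronwall inequality\<close>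

lemma at_within_atLeast_eq_atLeastAtMost:
  fixes a b t :: real
  assumes "t < b"
  shows "at t within {a..} = at t within {a..b}"
  by (rule at_within_nhd[of t "{..<b}"]) (use assms in auto)

text \<open>Near \<open>t\<close> the half-line coincides with \<open>{a..t + 1}\<close>. Locally
  uniform limits and indefinite integrals, which are controlled on compact intervals only, thus
  become continuous on the whole half-line.\<close>

lemma continuous_on_atLeast_iff:
  fixes f :: "real \<Rightarrow> 'a::topological_space"
  shows "continuous_on {a..} f \<longleftrightarrow> (\<forall>T. continuous_on {a..T} f)"
proof
  assume "\<forall>T. continuous_on {a..T} f"
  then have "(f \<longlongrightarrow> f t) (at t within {a..})" if "a \<le> t" for t
    using at_within_atLeast_eq_atLeastAtMost[of t "t + 1" a] that
    unfolding continuous_on_def by (metis atLeastAtMost_iff less_add_one less_imp_le)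
  then show "continuous_on {a..} f"
    unfolding continuous_on_def by simp
qed (auto intro: continuous_on_subset)

lemma continuous_on_Icc_norm_bounded:
  fixes f :: "real \<Rightarrow> 'a::real_normed_vector"
  assumes "continuous_on {0..} f"
  obtains B where "0 \<le> B" "\<And>t. 0 \<le> t \<Longrightarrow> t \<le> T \<Longrightarrow> norm (f t) \<le> B"
proof -
  have "bounded (f ` {0..T})"
    by (intro compact_imp_bounded compact_continuous_image continuous_on_subset[OF assms]) auto
  then obtain B where "B > 0" "\<forall>x\<in>f ` {0..T}. norm x \<le> B"
    by (auto simp: bounded_pos)
  with that[of B] show ?thesis by auto
qed

text \<open>The integrating factor \<open>exp (- C * t)\<close> makes the product nonincreasing.
  Neither \<open>C\<close> nor \<open>y\<close> has a prescribed sign, so the lemma also serves for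
  the negative function \<open>q - 1\<close> below. Differentiability is asked in the open interval
  only, which keeps one-sided derivatives out.\<close>

lemma gronwall_derivative_bound:
  fixes y y' :: "real \<Rightarrow> real"
  assumes "0 \<le> T" and cont: "continuous_on {0..T} y"
    and deriv: "\<And>t. 0 < t \<Longrightarrow> t < T \<Longrightarrow> (y has_real_derivative y' t) (at t)"
    and bound: "\<And>t. 0 < t \<Longrightarrow> t < T \<Longrightarrow> y' t \<le> C * y t"
  shows "y T \<le> y 0 * exp (C * T)"
proof -
  have "y T * exp (- C * T) \<le> y 0 * exp (- C * 0)"
  proof (rule DERIV_nonpos_imp_decreasing_open[OF \<open>0 \<le> T\<close>])
    fix t assume t: "0 < t" "t < T"
    have "((\<lambda>t. y t * exp (- C * t)) has_real_derivative (y' t - C * y t) * exp (- C * t)) (at t)"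
      using deriv[OF t] by (auto intro!: derivative_eq_intros simp: algebra_simps)
    moreover have "(y' t - C * y t) * exp (- C * t) \<le> 0"
      using bound[OF t] by (simp add: mult_le_0_iff)
    ultimately show "\<exists>d. ((\<lambda>t. y t * exp (- C * t)) has_real_derivative d) (at t) \<and> d \<le> 0"
      by blast
  qed (auto intro!: continuous_intros cont)
  then show ?thesis
    by (simp add: exp_minus field_simps)
qed

lemma has_vector_derivative_within_atLeast_imp_at:
  fixes t :: real
  assumes "(f has_vector_derivative d) (at t within {0..})" "0 < t"
  shows "(f has_vector_derivative d) (at t)"
  using assms at_within_interior[of t "{0..}"] by auto

text \<open>Unlike the norm, its square is differentiable even where \<open>e\<close> vanishes; both
  uses of Gronwall's inequality for curves in the space rely on this.\<close>

lemma has_real_derivative_inner_self: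
  assumes "(e has_vector_derivative d) (at t)"
  shows "((\<lambda>t. inner (e t) (e t)) has_real_derivative 2 * inner (e t) d) (at t)"
proof -
  have "((\<lambda>t. inner (e t) (e t)) has_derivative
      (\<lambda>s. inner (e t) (s *\<^sub>R d) + inner (s *\<^sub>R d) (e t))) (at t)"
    using assms unfolding has_vector_derivative_def by (intro has_derivative_inner)
  then show ?thesis
    unfolding has_field_derivative_def
    by (rule has_derivative_eq_rhs) (auto simp: inner_commute)
qed

section \<open>Lipschitz continuity on bounded sets, and uniqueness\<close>

text \<open>In infinite dimension this is stronger than local Lipschitz continuity, because closed
  balls are not compact. The sign of \<open>L\<close> is left free; the elimination rule supplies a
  nonnegative constant.\<close>

definition lipschitz_on_bounded :: "('a::real_normed_vector \<Rightarrow> real \<Rightarrow> 'a) \<Rightarrow> bool" where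
  "lipschitz_on_bounded f \<longleftrightarrow> (\<forall>R T. \<exists>L. \<forall>h k t. norm h \<le> R \<longrightarrow> norm k \<le> R \<longrightarrow> 0 \<le> t \<longrightarrow> t \<le> T \<longrightarrow>
      norm (f h t - f k t) \<le> L * norm (h - k))"

lemma lipschitz_on_boundedE:
  assumes "lipschitz_on_bounded f"
  obtains L where "0 \<le> L"
    "\<And>h k t. norm h \<le> R \<Longrightarrow> norm k \<le> R \<Longrightarrow> 0 \<le> t \<Longrightarrow> t \<le> T \<Longrightarrow>
      norm (f h t - f k t) \<le> L * norm (h - k)"
proof -
  obtain L where L: "\<forall>h k t. norm h \<le> R \<longrightarrow> norm k \<le> R \<longrightarrow> 0 \<le> t \<longrightarrow> t \<le> T \<longrightarrow>
      norm (f h t - f k t) \<le> L * norm (h - k)"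
    using assms unfolding lipschitz_on_bounded_def by blast
  have "norm (f h t - f k t) \<le> \<bar>L\<bar> * norm (h - k)"
    if "norm h \<le> R" "norm k \<le> R" "0 \<le> t" "t \<le> T" for h k t
    using L that by (meson abs_ge_self mult_right_mono norm_ge_zero order_trans)
  with that[of "\<bar>L\<bar>"] show ?thesis by simp
qed

text \<open>Replaces joint continuity of \<open>f\<close>: the increment splits into a change of the
  first argument, controlled by the Lipschitz bound, and a change of time with the first argument
  frozen at \<open>c t\<close>.\<close>

lemma lipschitz_on_bounded_continuous_along:
  fixes c :: "real \<Rightarrow> 'a::real_normed_vector"
  assumes lip: "lipschitz_on_bounded f" and cont: "\<And>h. continuous_on {0..} (f h)"
    and c: "continuous_on {0..} c"
  shows "continuous_on {0..} (\<lambda>t. f (c t) t)"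
  unfolding continuous_on_def
proof
  fix t :: real assume "t \<in> {0..}"
  then have t: "0 \<le> t" by simp
  let ?F = "at t within {0..}"
  obtain B where B: "\<And>s. 0 \<le> s \<Longrightarrow> s \<le> t + 1 \<Longrightarrow> norm (c s) \<le> B"
    using continuous_on_Icc_norm_bounded[OF c, of "t + 1"] by blast
  obtain L where "0 \<le> L" and L: "\<And>h k s. norm h \<le> B \<Longrightarrow> norm k \<le> B \<Longrightarrow> 0 \<le> s \<Longrightarrow> s \<le> t + 1 \<Longrightarrow>
      norm (f h s - f k s) \<le> L * norm (h - k)"
    using lipschitz_on_boundedE[OF lip, of B "t + 1"] by blast
  have ev: "eventually (\<lambda>s. 0 \<le> s \<and> s \<le> t + 1) ?F"
    unfolding eventually_at using t by (intro exI[of _ 1]) (auto simp: dist_real_def)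
  have "((\<lambda>s. L * norm (c s - c t)) \<longlongrightarrow> L * norm (c t - c t)) ?F"
    using c t by (intro tendsto_intros) (auto simp: continuous_on_def)
  then have "((\<lambda>s. L * norm (c s - c t)) \<longlongrightarrow> 0) ?F" by simp
  then have "((\<lambda>s. f (c s) s - f (c t) s) \<longlongrightarrow> 0) ?F"
    by (rule Lim_null_comparison[rotated])
      (use ev in eventually_elim, use L B t in auto)
  moreover have "((\<lambda>s. f (c t) s) \<longlongrightarrow> f (c t) t) ?F"
    using cont t by (auto simp: continuous_on_def)
  ultimately have "((\<lambda>s. (f (c s) s - f (c t) s) + f (c t) s) \<longlongrightarrow> 0 + f (c t) t) ?F"
    by (rule tendsto_add)
  then show "((\<lambda>s. f (c s) s) \<longlongrightarrow> f (c t) t) ?F" by simp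
qed

lemma solves_cauchy_continuous: "solves_cauchy f z\<^sub>0 z \<Longrightarrow> continuous_on {0..} z"
  unfolding solves_cauchy_def
  by (auto intro!: continuous_on_vector_derivative)

text \<open>On \<open>{0..T}\<close> both solutions stay in one ball, where \<open>f\<close> has a
  Lipschitz constant \<open>L\<close>; the squared distance then grows at rate at most
  \<open>2 * L\<close> from the value 0.\<close>

lemma solves_cauchy_unique:
  fixes f :: "'a::real_inner \<Rightarrow> real \<Rightarrow> 'a"
  assumes lip: "lipschitz_on_bounded f"
    and w: "solves_cauchy f z\<^sub>0 w" and z: "solves_cauchy f z\<^sub>0 z" and T: "0 \<le> T"
  shows "w T = z T"
proof -
  note cw = solves_cauchy_continuous[OF w] and cz = solves_cauchy_continuous[OF z]
  obtain Bw where Bw: "\<And>s. 0 \<le> s \<Longrightarrow> s \<le> T \<Longrightarrow> norm (w s) \<le> Bw"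
    using continuous_on_Icc_norm_bounded[OF cw] by blast
  obtain Bz where Bz: "\<And>s. 0 \<le> s \<Longrightarrow> s \<le> T \<Longrightarrow> norm (z s) \<le> Bz"
    using continuous_on_Icc_norm_bounded[OF cz] by blast
  obtain L where L: "\<And>h k s. norm h \<le> max Bw Bz \<Longrightarrow> norm k \<le> max Bw Bz \<Longrightarrow> 0 \<le> s \<Longrightarrow> s \<le> T \<Longrightarrow>
      norm (f h s - f k s) \<le> L * norm (h - k)"
    using lipschitz_on_boundedE[OF lip] by blast
  let ?e = "\<lambda>t. w t - z t" and ?d = "\<lambda>t. f (w t) t - f (z t) t"
  have "inner (?e T) (?e T) \<le> inner (?e 0) (?e 0) * exp (2 * L * T)"
  proof (rule gronwall_derivative_bound[OF T])
    show "continuous_on {0..T} (\<lambda>t. inner (?e t) (?e t))"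
      by (intro continuous_intros continuous_on_subset[OF cw] continuous_on_subset[OF cz]) auto
    fix t assume t: "0 < t" "t < T"
    show "((\<lambda>t. inner (?e t) (?e t)) has_real_derivative 2 * inner (?e t) (?d t)) (at t)"
      using w z t unfolding solves_cauchy_def
      by (intro has_real_derivative_inner_self has_vector_derivative_diff
          has_vector_derivative_within_atLeast_imp_at) auto
    have "inner (?e t) (?d t) \<le> norm (?e t) * norm (?d t)"
      by (rule norm_cauchy_schwarz)
    also have "\<dots> \<le> norm (?e t) * (L * norm (?e t))"
      using t Bw[of t] Bz[of t] by (intro mult_left_mono L) auto
    finally show "2 * inner (?e t) (?d t) \<le> 2 * L * inner (?e t) (?e t)"
      by (simp add: dot_square_norm power2_eq_square algebra_simps)
  qed
  also have "?e 0 = 0"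
    using w z by (simp add: solves_cauchy_def)
  finally have "inner (?e T) (?e T) \<le> 0" by simp
  then show ?thesis
    by (metis inner_gt_zero_iff not_le right_minus_eq)
qed

section \<open>Global existence by Picard iteration\<close>

primrec picard_iterate ::
    "('a::real_normed_vector \<Rightarrow> real \<Rightarrow> 'a) \<Rightarrow> 'a \<Rightarrow> nat \<Rightarrow> real \<Rightarrow> 'a" where
  "picard_iterate f z\<^sub>0 0 t = z\<^sub>0"
| "picard_iterate f z\<^sub>0 (Suc n) t = z\<^sub>0 + integral {0..t} (\<lambda>s. f (picard_iterate f z\<^sub>0 n s) s)"

text \<open>Integration divides an exponentially weighted bound by \<open>b\<close>. Choosing
  \<open>b\<close> as twice the Lipschitz constant turns the Picard step into a contraction on an
  interval of any length.\<close>

lemma integral_exp_bound: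
  fixes g :: "real \<Rightarrow> 'a::banach"
  assumes g: "continuous_on {0..t} g" and "0 < b" "0 \<le> t" "0 \<le> a"
    and le: "\<And>s. 0 \<le> s \<Longrightarrow> s \<le> t \<Longrightarrow> norm (g s) \<le> a * exp (b * s)"
  shows "norm (integral {0..t} g) \<le> a / b * exp (b * t)"
proof -
  have I: "((\<lambda>s. a * exp (b * s)) has_integral a / b * exp (b * t) - a / b * exp (b * 0)) {0..t}"
    using \<open>0 < b\<close> \<open>0 \<le> t\<close>
    by (intro fundamental_theorem_of_calculus)
      (auto intro!: derivative_eq_intros simp flip: has_real_derivative_iff_has_vector_derivative)
  have "norm (integral {0..t} g) \<le> integral {0..t} (\<lambda>s. a * exp (b * s))"
    using le by (intro integral_norm_bound_integral integrable_continuous_real g has_integral_integrable[OF I]) auto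
  also have "\<dots> = a / b * exp (b * t) - a / b * exp (b * 0)"
    using I by (rule integral_unique)
  also have "\<dots> \<le> a / b * exp (b * t)"
    using \<open>0 < b\<close> \<open>0 \<le> a\<close> by simp
  finally show ?thesis .
qed

text \<open>The Lipschitz bound is global in \<open>h\<close> and may depend on \<open>T\<close>.
  With the exponential weight the iterates converge on every \<open>{0..T}\<close> at once, so no
  local solutions have to be glued.\<close>

theorem picard_lindeloef_global:
  fixes f :: "'a::banach \<Rightarrow> real \<Rightarrow> 'a"
  assumes lip: "\<And>T. \<exists>L. \<forall>h k t. 0 \<le> t \<longrightarrow> t \<le> T \<longrightarrow> norm (f h t - f k t) \<le> L * norm (h - k)"
    and cont: "\<And>h. continuous_on {0..} (f h)"
  shows "\<exists>z. solves_cauchy f z\<^sub>0 z"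
proof -
  let ?Z = "picard_iterate f z\<^sub>0"
  have bl: "lipschitz_on_bounded f"
    using lip unfolding lipschitz_on_bounded_def by meson
  have cint: "continuous_on {0..} (\<lambda>t. z\<^sub>0 + integral {0..t} g)" if "continuous_on {0..} g" for g :: "real \<Rightarrow> 'a"
    unfolding continuous_on_atLeast_iff
    by (intro allI continuous_intros indefinite_integral_continuous_1 integrable_continuous_real
        continuous_on_subset[OF that]) auto
  have cZ: "continuous_on {0..} (?Z n)" for n
    by (induction n)
      (auto intro!: cint lipschitz_on_bounded_continuous_along[OF bl cont])
  have cfZ: "continuous_on {0..} (\<lambda>s. f (?Z n s) s)" for n
    by (intro lipschitz_on_bounded_continuous_along[OF bl cont] cZ)
  let ?D = "\<lambda>n t. ?Z (Suc n) t - ?Z n t"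
  \<comment> \<open>Writing the limit as the telescoping series of increments fixes one function for
    all \<open>T\<close>, and lets the Weierstrass test apply.\<close>
  define z where "z = (\<lambda>t. z\<^sub>0 + suminf (\<lambda>n. ?D n t))"
  have unif: "uniform_limit {0..T} ?Z z sequentially" for T
  proof -
    obtain L0 where L0: "\<forall>h k t. 0 \<le> t \<longrightarrow> t \<le> T \<longrightarrow> norm (f h t - f k t) \<le> L0 * norm (h - k)"
      using lip by blast
    \<comment> \<open>The maximum with 1 makes \<open>L\<close> positive, so that
      \<open>2 * L\<close> can serve as exponential rate and as divisor.\<close>
    define L where "L = max L0 1"
    have L1: "1 \<le> L" by (simp add: L_def)
    have L: "norm (f h t - f k t) \<le> L * norm (h - k)" if "0 \<le> t" "t \<le> T" for h k t
    proof -
      have "norm (f h t - f k t) \<le> L0 * norm (h - k)"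
        using L0 that by blast
      also have "\<dots> \<le> L * norm (h - k)"
        by (intro mult_right_mono) (auto simp: L_def)
      finally show ?thesis .
    qed
    obtain K where K: "0 \<le> K" "\<And>t. 0 \<le> t \<Longrightarrow> t \<le> T \<Longrightarrow> norm (?D 0 t) \<le> K"
      using continuous_on_Icc_norm_bounded[OF continuous_on_diff[OF cZ cZ]] by metis
    \<comment> \<open>the weight \<open>exp (2 * L * t)\<close> makes every iteration step gain a factor \<open>1/2\<close>\<close>
    have D: "norm (?D n t) \<le> K * (1/2)^n * exp (2 * L * t)" if "0 \<le> t" "t \<le> T" for n t
      using that
    proof (induction n arbitrary: t)
      case 0
      have "K * 1 \<le> K * exp (2 * L * t)"
        using K(1) L1 0 by (intro mult_left_mono) auto
      then show ?case using K(2)[OF 0] by simp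
    next
      case (Suc n)
      have c: "continuous_on {0..t} (\<lambda>s. f (?Z n s) s)" for n
        by (rule continuous_on_subset[OF cfZ]) auto
      have "?D (Suc n) t = integral {0..t} (\<lambda>s. f (?Z (Suc n) s) s - f (?Z n s) s)"
        by (subst integral_diff) (use c[of n] c[of "Suc n"] in \<open>auto intro!: integrable_continuous_real\<close>)
      also have "norm \<dots> \<le> L * (K * (1/2)^n) / (2 * L) * exp (2 * L * t)"
      proof (rule integral_exp_bound)
        fix s assume s: "0 \<le> s" "s \<le> t"
        have "norm (f (?Z (Suc n) s) s - f (?Z n s) s) \<le> L * norm (?D n s)"
          using s Suc.prems by (intro L) auto
        also have "\<dots> \<le> L * (K * (1/2)^n * exp (2 * L * s))"
          using s Suc.prems L1 by (intro mult_left_mono Suc.IH) auto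
        finally show "norm (f (?Z (Suc n) s) s - f (?Z n s) s) \<le> L * (K * (1/2)^n) * exp (2 * L * s)"
          by (simp only: mult.assoc)
      qed (use L1 K(1) Suc.prems in \<open>auto intro!: continuous_on_diff c simp del: picard_iterate.simps\<close>)
      also have "L * (K * (1/2)^n) / (2 * L) = K * (1/2)^Suc n"
        using L1 by simp
      finally show ?case .
    qed
    have "uniform_limit {0..T} (\<lambda>n t. \<Sum>i<n. ?D i t) (\<lambda>t. suminf (\<lambda>i. ?D i t)) sequentially"
    proof (rule Weierstrass_m_test)
      fix n t assume t: "t \<in> {0..T}"
      have "K * (1/2)^n * exp (2 * L * t) \<le> K * (1/2)^n * exp (2 * L * T)"
        using t K(1) L1 by (intro mult_left_mono) auto
      with D[of t n] t show "norm (?D n t) \<le> K * (1/2)^n * exp (2 * L * T)"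
        by (simp del: picard_iterate.simps)
    qed (auto intro!: summable_mult summable_mult2 summable_geometric)
    then have "uniform_limit {0..T} (\<lambda>n t. ?Z n t - z\<^sub>0) (\<lambda>t. suminf (\<lambda>i. ?D i t)) sequentially"
      by (subst (asm) sum_lessThan_telescope) simp
    then have "uniform_limit {0..T} (\<lambda>n t. z\<^sub>0 + (?Z n t - z\<^sub>0)) (\<lambda>t. z\<^sub>0 + suminf (\<lambda>i. ?D i t)) sequentially"
      by (intro uniform_limit_intros)
    then show ?thesis by (simp add: z_def)
  qed
  have cz: "continuous_on {0..} z"
    unfolding continuous_on_atLeast_iff
    by (intro allI uniform_limit_theorem[OF _ unif] always_eventually continuous_on_subset[OF cZ]) auto
  have cfz: "continuous_on {0..} (\<lambda>s. f (z s) s)"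
    by (intro lipschitz_on_bounded_continuous_along[OF bl cont] cz)
  have int_eq: "z t = z\<^sub>0 + integral {0..t} (\<lambda>s. f (z s) s)" if "0 \<le> t" for t
  proof -
    obtain L where L: "\<forall>h k s. 0 \<le> s \<longrightarrow> s \<le> t \<longrightarrow> norm (f h s - f k s) \<le> L * norm (h - k)"
      using lip by blast
    \<comment> \<open>The Lipschitz bound carries uniform convergence over to the integrands, so the
      limit may be taken under the integral. The divisor \<open>\<bar>L\<bar> + 1\<close> below is
      positive whatever the sign of \<open>L\<close>.\<close>
    have "uniform_limit {0..t} (\<lambda>n s. f (?Z n s) s) (\<lambda>s. f (z s) s) sequentially"
    proof (rule uniform_limitI)
      fix e :: real assume e: "0 < e"
      have "0 < e / (\<bar>L\<bar> + 1)" using e by simp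
      then have "\<forall>\<^sub>F n in sequentially. \<forall>s\<in>{0..t}. dist (?Z n s) (z s) < e / (\<bar>L\<bar> + 1)"
        using unif[of t] by (rule uniform_limitD[rotated])
      then show "\<forall>\<^sub>F n in sequentially. \<forall>s\<in>{0..t}. dist (f (?Z n s) s) (f (z s) s) < e"
      proof eventually_elim
        case (elim n)
        show ?case
        proof
          fix s assume s: "s \<in> {0..t}"
          have "norm (f (?Z n s) s - f (z s) s) \<le> L * norm (?Z n s - z s)"
            using L s by auto
          also have "\<dots> \<le> (\<bar>L\<bar> + 1) * norm (?Z n s - z s)"
            by (intro mult_right_mono) auto
          also have "\<dots> < e"
            using elim s by (simp add: dist_norm field_simps)
          finally show "dist (f (?Z n s) s) (f (z s) s) < e"
            by (simp add: dist_norm)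
        qed
      qed
    qed
    then obtain I J where I: "\<And>n. ((\<lambda>s. f (?Z n s) s) has_integral I n) {0..t}"
      and J: "((\<lambda>s. f (z s) s) has_integral J) {0..t}" and IJ: "I \<longlonglongrightarrow> J"
      by (rule uniform_limit_integral) (auto intro: continuous_on_subset[OF cfZ])
    have "(\<lambda>n. ?Z (Suc n) t) \<longlonglongrightarrow> z\<^sub>0 + J"
      using tendsto_add[OF tendsto_const IJ, of z\<^sub>0] integral_unique[OF I] by simp
    moreover have "(\<lambda>n. ?Z (Suc n) t) \<longlonglongrightarrow> z t"
      using tendsto_uniform_limitI[OF unif[of t], of t] that by (intro LIMSEQ_Suc) auto
    ultimately show ?thesis
      using LIMSEQ_unique integral_unique[OF J] by blast
  qed
  have "solves_cauchy f z\<^sub>0 z"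
    unfolding solves_cauchy_def
  proof (intro conjI allI impI)
    show "z 0 = z\<^sub>0" using int_eq[of 0] by simp
    fix t :: real assume t: "0 \<le> t"
    \<comment> \<open>The endpoint \<open>t + 1\<close> leaves room to the right of
      \<open>t\<close>, so that the derivative within the interval is the one within the
      half-line.\<close>
    have "((\<lambda>u. integral {0..u} (\<lambda>s. f (z s) s)) has_vector_derivative f (z t) t) (at t within {0..t+1})"
      by (rule integral_has_vector_derivative) (use t in \<open>auto intro: continuous_on_subset[OF cfz]\<close>)
    then have "((\<lambda>u. z\<^sub>0 + integral {0..u} (\<lambda>s. f (z s) s)) has_vector_derivative f (z t) t) (at t within {0..t+1})"
      by (auto intro!: derivative_eq_intros)
    then have "(z has_vector_derivative f (z t) t) (at t within {0..t+1})"
      by (rule has_vector_derivative_transform[rotated 2]) (use t int_eq in auto)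
    then show "(z has_vector_derivative f (z t) t) (at t within {0..})"
      using at_within_atLeast_eq_atLeastAtMost[of t "t + 1" 0] by simp
  qed
  then show ?thesis by blast
qed

section \<open>Transfer of the existence theorem along an isometry\<close>

text \<open>
  The sort \<open>{real_normed_vector, complete_space}\<close> is not contained in the class \<open>banach\<close>, although the
  latter adds no axiom, so the integral is not available on it. An isomorphic copy of the type can
  be made an instance of \<open>banach\<close>.
\<close>

datatype 'a copy = Copy (uncopy: 'a)

instantiation copy :: (real_normed_vector) real_normed_vector
begin

definition "0 = Copy 0"
definition "x + y = Copy (uncopy x + uncopy y)"
definition "x - y = Copy (uncopy x - uncopy y)"
definition "- x = Copy (- uncopy x)"
definition "r *\<^sub>R x = Copy (r *\<^sub>R uncopy x)"
definition "norm x = norm (uncopy x)"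
definition "dist x y = dist (uncopy x) (uncopy y)"
definition "sgn x = Copy (sgn (uncopy x))"
definition "uniformity = (INF e\<in>{0<..}. principal {(x :: 'a copy, y). dist x y < e})"
definition "open U \<longleftrightarrow> (\<forall>x\<in>U. eventually (\<lambda>(x', y). x' = x \<longrightarrow> y \<in> U) uniformity)"
  for U :: "'a copy set"

instance
  by standard
    (auto simp: zero_copy_def plus_copy_def minus_copy_def uminus_copy_def scaleR_copy_def norm_copy_def
      dist_copy_def sgn_copy_def uniformity_copy_def open_copy_def algebra_simps dist_norm sgn_div_norm
      norm_triangle_ineq intro: copy.expand)

end

lemma bounded_linear_uncopy: "bounded_linear uncopy"
  by (rule bounded_linear_intro[where K = 1])
    (simp_all add: plus_copy_def scaleR_copy_def norm_copy_def)

lemma bounded_linear_Copy: "bounded_linear Copy"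
  by (rule bounded_linear_intro[where K = 1])
    (simp_all add: plus_copy_def scaleR_copy_def norm_copy_def)

instance copy :: ("{real_normed_vector, complete_space}") banach
proof
  fix X :: "nat \<Rightarrow> 'a copy"
  assume "Cauchy X"
  then have "Cauchy (\<lambda>n. uncopy (X n))"
    by (simp add: Cauchy_def dist_copy_def)
  then obtain l where "(\<lambda>n. uncopy (X n)) \<longlonglongrightarrow> l"
    using Cauchy_convergent convergent_def by blast
  then have "(\<lambda>n. Copy (uncopy (X n))) \<longlonglongrightarrow> Copy l"
    by (rule bounded_linear.tendsto[OF bounded_linear_Copy])
  then show "convergent X"
    by (auto simp: convergent_def)
qed

corollary picard_lindeloef_global_complete:
  fixes f :: "'a::{real_normed_vector, complete_space} \<Rightarrow> real \<Rightarrow> 'a"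
  assumes lip: "\<And>T. \<exists>L. \<forall>h k t. 0 \<le> t \<longrightarrow> t \<le> T \<longrightarrow> norm (f h t - f k t) \<le> L * norm (h - k)"
    and cont: "\<And>h. continuous_on {0..} (f h)"
  shows "\<exists>z. solves_cauchy f z\<^sub>0 z"
proof -
  let ?g = "\<lambda>h t. Copy (f (uncopy h) t)"
  have "\<exists>z. solves_cauchy ?g (Copy z\<^sub>0) z"
  proof (rule picard_lindeloef_global)
    show "\<exists>L. \<forall>h k t. 0 \<le> t \<longrightarrow> t \<le> T \<longrightarrow> norm (?g h t - ?g k t) \<le> L * norm (h - k)" for T
      using lip[of T] by (auto simp: norm_copy_def minus_copy_def)
    show "continuous_on {0..} (?g h)" for h
      by (rule bounded_linear.continuous_on[OF bounded_linear_Copy cont])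
  qed
  then obtain z where "solves_cauchy ?g (Copy z\<^sub>0) z" ..
  then have "solves_cauchy f z\<^sub>0 (\<lambda>t. uncopy (z t))"
    unfolding solves_cauchy_def
    using bounded_linear.has_vector_derivative[OF bounded_linear_uncopy] by fastforce
  then show ?thesis by blast
qed


section \<open>A barrier lemma, the radial retraction, and the Lipschitz property from bounded
  derivatives\<close>

text \<open>By compactness there is a first time \<open>T\<close> with \<open>q T \<ge> 1\<close>.
  Before it the differential inequality is available, and Gronwall for \<open>q - 1\<close> with
  rate \<open>- C\<close> keeps \<open>q T - 1\<close> strictly negative.\<close>

lemma less_one_if_derivative_bound:
  fixes q q' :: "real \<Rightarrow> real"
  assumes cont: "continuous_on {0..} q" and "q 0 < 1"
    and deriv: "\<And>t. 0 < t \<Longrightarrow> (q has_real_derivative q' t) (at t)"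
    and bound: "\<And>T. \<exists>C. \<forall>t. 0 < t \<longrightarrow> t < T \<longrightarrow> q t < 1 \<longrightarrow> q' t \<le> C * (1 - q t)"
    and "0 \<le> t"
  shows "q t < 1"
proof (rule ccontr)
  assume "\<not> q t < 1"
  define S where "S = {s \<in> {0..t}. 1 \<le> q s}"
  have "continuous_on {0..t} q"
    by (rule continuous_on_subset[OF cont]) auto
  then have "closed S"
    unfolding S_def by (intro closed_Collect_le continuous_on_closed_Collect_le) auto
  then have "compact S"
    by (auto simp: compact_eq_bounded_closed S_def intro: bounded_subset[of "{0..t}"])
  moreover have "t \<in> S"
    using \<open>\<not> q t < 1\<close> \<open>0 \<le> t\<close> by (simp add: S_def)
  ultimately obtain T where T: "T \<in> S" and first: "\<And>s. s \<in> S \<Longrightarrow> T \<le> s"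
    using compact_attains_inf[of S] by blast
  have below: "q s < 1" if "0 \<le> s" "s < T" for s
    using first[of s] that T by (force simp: S_def)
  obtain C where C: "\<forall>t. 0 < t \<longrightarrow> t < T \<longrightarrow> q t < 1 \<longrightarrow> q' t \<le> C * (1 - q t)"
    using bound by blast
  have "q T - 1 \<le> (q 0 - 1) * exp (- C * T)"
  proof (rule gronwall_derivative_bound)
    fix s assume s: "0 < s" "s < T"
    then show "((\<lambda>s. q s - 1) has_real_derivative q' s) (at s)"
      by (auto intro!: derivative_eq_intros deriv)
    show "q' s \<le> - C * (q s - 1)"
      using C below[of s] s by (auto simp: algebra_simps)
  qed (use T in \<open>auto simp: S_def intro!: continuous_intros continuous_on_subset[OF cont]\<close>)
  also have "\<dots> < 0"
    using \<open>q 0 < 1\<close> by (simp add: mult_less_0_iff)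
  finally show False
    using T by (simp add: S_def)
qed

definition radial_retraction :: "'a::real_normed_vector \<Rightarrow> 'a" where
  "radial_retraction y = y /\<^sub>R max 1 (norm y)"

lemma norm_radial_retraction_le: "norm (radial_retraction y) \<le> 1"
  by (simp add: radial_retraction_def field_simps)

lemma radial_retraction_eq: "norm y \<le> 1 \<Longrightarrow> radial_retraction y = y"
  by (simp add: radial_retraction_def max_def)

text \<open>With \<open>a\<close>, \<open>b\<close> the two denominators, the difference is
  \<open>(y - w) / a\<close> plus \<open>(b - a) / (a * b)\<close> times \<open>w\<close>, and each
  summand has norm at most \<open>norm (y - w)\<close>. The constant 2 is valid in every normed
  space.\<close>

lemma radial_retraction_lipschitz:
  "norm (radial_retraction y - radial_retraction w) \<le> 2 * norm (y - w)"
proof -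
  define a b where "a = max 1 (norm y)" and "b = max 1 (norm w)"
  have ab: "1 \<le> a" "1 \<le> b" and "norm w \<le> b" by (auto simp: a_def b_def)
  have ba: "\<bar>b - a\<bar> \<le> norm (y - w)"
    using norm_triangle_ineq3[of y w] by (auto simp: a_def b_def max_def)
  have "radial_retraction y - radial_retraction w = (1 / a) *\<^sub>R (y - w) + ((b - a) / (a * b)) *\<^sub>R w"
    using ab unfolding radial_retraction_def a_def[symmetric] b_def[symmetric]
    by (simp add: algebra_simps divide_simps flip: scaleR_left.diff)
      (simp add: algebra_simps diff_divide_distrib)
  also have "norm \<dots> \<le> 1 / a * norm (y - w) + \<bar>b - a\<bar> / a * (norm w / b)"
    using ab by (intro norm_triangle_le) (simp add: abs_mult)
  also have "\<dots> \<le> 1 * norm (y - w) + norm (y - w) * 1"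
  proof (intro add_mono mult_mono)
    have "\<bar>b - a\<bar> / a \<le> \<bar>b - a\<bar>"
      using ab by (simp add: divide_le_eq mult_left_mono[of 1 a, simplified])
    with ba show "\<bar>b - a\<bar> / a \<le> norm (y - w)" by simp
  qed (use ab \<open>norm w \<le> b\<close> in auto)
  finally show ?thesis by simp
qed

lemma continuous_on_radial_retraction [continuous_intros]:
  "continuous_on S g \<Longrightarrow> continuous_on S (\<lambda>t. radial_retraction (g t))"
  unfolding radial_retraction_def by (intro continuous_intros) (auto simp: max_def)

text \<open>The mean value inequality on the convex set \<open>cball 0 R\<close>.\<close>

lemma lipschitz_on_boundedI_onorm:
  assumes diff: "\<And>h t. 0 \<le> t \<Longrightarrow> (\<lambda>h. \<Phi> h t) differentiable (at h)"
    and bdd: "\<And>R T. \<exists>M. \<forall>h t. norm h \<le> R \<longrightarrow> 0 \<le> t \<longrightarrow> t \<le> T \<longrightarrow>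
          onorm (frechet_derivative (\<lambda>h. \<Phi> h t) (at h)) \<le> M"
  shows "lipschitz_on_bounded \<Phi>"
  unfolding lipschitz_on_bounded_def
proof (intro allI)
  fix R T
  obtain M where M: "\<forall>h t. norm h \<le> R \<longrightarrow> 0 \<le> t \<longrightarrow> t \<le> T \<longrightarrow>
      onorm (frechet_derivative (\<lambda>h. \<Phi> h t) (at h)) \<le> M"
    using bdd by blast
  have "norm (\<Phi> h t - \<Phi> k t) \<le> M * norm (h - k)"
    if "norm h \<le> R" "norm k \<le> R" "0 \<le> t" "t \<le> T" for h k t
  proof (rule differentiable_bound[of "cball 0 R"])
    show "((\<lambda>h. \<Phi> h t) has_derivative frechet_derivative (\<lambda>h. \<Phi> h t) (at h)) (at h within cball 0 R)" for h
      using diff[OF \<open>0 \<le> t\<close>] by (auto simp: frechet_derivative_works intro: has_derivative_at_withinI)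
  qed (use M that in auto)
  then show "\<exists>L. \<forall>h k t. norm h \<le> R \<longrightarrow> norm k \<le> R \<longrightarrow> 0 \<le> t \<longrightarrow> t \<le> T \<longrightarrow>
      norm (\<Phi> h t - \<Phi> k t) \<le> L * norm (h - k)"
    by blast
qed

section \<open>The tube of radius \<open>1 / \<mu> t\<close> around \<open>x t\<close>\<close>

theorem theorem2p4:
  fixes \<Phi> :: "'a::{real_inner, complete_space} \<Rightarrow> real \<Rightarrow> 'a"
    and z\<^sub>0 :: 'a
    and x x' :: "real \<Rightarrow> 'a"
    and \<alpha> \<beta> \<gamma> \<sigma> \<mu> \<mu>' :: "real \<Rightarrow> real"
  assumes \<Phi>_diff: "\<And>h t. 0 \<le> t \<Longrightarrow> (\<lambda>h. \<Phi> h t) differentiable (at h)"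
    and \<Phi>_cont: "\<And>h. continuous_on {0..} (\<lambda>t. \<Phi> h t)"
    and \<Phi>_deriv_bdd: "\<And>R T. \<exists>M. \<forall>h t. norm h \<le> R \<longrightarrow> 0 \<le> t \<longrightarrow> t \<le> T \<longrightarrow>
          onorm (frechet_derivative (\<lambda>h. \<Phi> h t) (at h)) \<le> M"
    and x_deriv: "\<And>t. 0 \<le> t \<Longrightarrow> (x has_vector_derivative x' t) (at t within {0..})"
    and \<alpha>_cont: "continuous_on {0..} \<alpha>" and \<alpha>_nonneg: "\<And>t. 0 \<le> t \<Longrightarrow> 0 \<le> \<alpha> t"
    and \<gamma>_cont: "continuous_on {0..} \<gamma>"
    and \<sigma>_cont: "continuous_on {0..} \<sigma>"
    and \<Phi>_ineq: "\<And>h t. 0 \<le> t \<Longrightarrow>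
          inner (\<Phi> h t) (h - x t) \<le>
            \<alpha> t * norm (h - x t) - \<gamma> t * (norm (h - x t))\<^sup>2 + \<sigma> t * (norm (h - x t)) ^ 3"
    and \<beta>_eq: "\<And>t. 0 \<le> t \<Longrightarrow> \<beta> t = norm (x' t) + \<alpha> t"
    and \<beta>_cont: "continuous_on {0..} \<beta>"
    and \<mu>_pos: "\<And>t. 0 \<le> t \<Longrightarrow> 0 < \<mu> t"
    and \<mu>_deriv: "\<And>t. 0 \<le> t \<Longrightarrow> (\<mu> has_real_derivative \<mu>' t) (at t within {0..})"
    and \<mu>'_cont: "continuous_on {0..} \<mu>'"
    and \<mu>_lim: "filterlim \<mu> at_top at_top"
    and \<sigma>_nonneg: "\<And>t. 0 \<le> t \<Longrightarrow> 0 \<le> \<sigma> t"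
    and \<sigma>_le: "\<And>t. 0 \<le> t \<Longrightarrow> \<sigma> t \<le> \<mu> t / 2 * (\<gamma> t - \<mu>' t / \<mu> t)"
    and \<beta>_le: "\<And>t. 0 \<le> t \<Longrightarrow> \<beta> t \<le> 1 / (2 * \<mu> t) * (\<gamma> t - \<mu>' t / \<mu> t)"
    and init: "\<mu> 0 * norm (z\<^sub>0 - x 0) < 1"
  shows "\<exists>z. solves_cauchy \<Phi> z\<^sub>0 z
           \<and> (\<forall>w. solves_cauchy \<Phi> z\<^sub>0 w \<longrightarrow> (\<forall>t\<ge>0. w t = z t))
           \<and> (\<forall>t\<ge>0. norm (z t - x t) < 1 / \<mu> t)
           \<and> ((\<lambda>t. norm (z t - x t)) \<longlongrightarrow> 0) at_top"
proof -
  have lip: "lipschitz_on_bounded \<Phi>"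
    using \<Phi>_diff \<Phi>_deriv_bdd by (rule lipschitz_on_boundedI_onorm)
  have cx: "continuous_on {0..} x"
    using x_deriv by (intro continuous_on_vector_derivative) auto
  have c\<mu>: "continuous_on {0..} \<mu>"
    using \<mu>_deriv by (intro DERIV_continuous_on) auto
  have \<mu>_ne: "\<mu> t \<noteq> 0" if "0 \<le> t" for t
    using \<mu>_pos[OF that] by simp
  \<comment> \<open>The retraction onto the closed ball of the tube at time \<open>t\<close>,
    rescaled to the unit ball. The factors \<open>\<mu> t\<close> and \<open>1 / \<mu> t\<close>
    cancel in its Lipschitz constant, which is 2 for all times.\<close>
  define r where "r = (\<lambda>h t. x t + (1 / \<mu> t) *\<^sub>R radial_retraction (\<mu> t *\<^sub>R (h - x t)))"
  have r_bound: "norm (r h t) \<le> norm (x t) + norm (1 / \<mu> t)" for h t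
    unfolding r_def
    by (intro order_trans[OF norm_triangle_ineq] add_left_mono)
      (auto intro!: divide_right_mono simp: norm_radial_retraction_le)
  have r_lip: "norm (r h t - r k t) \<le> 2 * norm (h - k)" if "0 \<le> t" for h k t
  proof -
    have "norm (r h t - r k t) = 1 / \<mu> t *
        norm (radial_retraction (\<mu> t *\<^sub>R (h - x t)) - radial_retraction (\<mu> t *\<^sub>R (k - x t)))"
      unfolding r_def using \<mu>_pos[OF that] by (simp flip: scaleR_diff_right)
    also have "\<dots> \<le> 1 / \<mu> t * (2 * norm (\<mu> t *\<^sub>R (h - x t) - \<mu> t *\<^sub>R (k - x t)))"
      using \<mu>_pos[OF that] by (intro mult_left_mono radial_retraction_lipschitz) auto
    also have "\<mu> t *\<^sub>R (h - x t) - \<mu> t *\<^sub>R (k - x t) = \<mu> t *\<^sub>R (h - k)"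
      by (simp flip: scaleR_diff_right)
    also have "1 / \<mu> t * (2 * norm \<dots>) = 2 * norm (h - k)"
      using \<mu>_pos[OF that] by simp
    finally show ?thesis .
  qed
  have r_eq: "r h t = h" if "0 \<le> t" "\<mu> t * norm (h - x t) \<le> 1" for h t
    using that \<mu>_pos[of t] by (simp add: r_def radial_retraction_eq)
  have cr: "continuous_on {0..} (r h)" for h
    unfolding r_def using \<mu>_ne by (auto intro!: continuous_intros cx c\<mu>)
  define f where "f = (\<lambda>h t. \<Phi> (r h t) t)"
  have "\<exists>z. solves_cauchy f z\<^sub>0 z"
  proof (rule picard_lindeloef_global_complete)
    show "continuous_on {0..} (f h)" for h
      unfolding f_def by (rule lipschitz_on_bounded_continuous_along[OF lip \<Phi>_cont cr])
    fix T
    \<comment> \<open>Over \<open>{0..T}\<close> the tube lies in one ball of radius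
      \<open>R\<close>, so a Lipschitz constant of \<open>\<Phi>\<close> on that ball yields one for
      \<open>f\<close> valid for all \<open>h\<close>.\<close>
    have "continuous_on {0..} (\<lambda>t. norm (x t) + norm (1 / \<mu> t))"
      using \<mu>_ne by (auto intro!: continuous_intros cx c\<mu>)
    then obtain R where R: "\<And>t. 0 \<le> t \<Longrightarrow> t \<le> T \<Longrightarrow> norm (norm (x t) + norm (1 / \<mu> t)) \<le> R"
      using continuous_on_Icc_norm_bounded by blast
    have rR: "norm (r h t) \<le> R" if "0 \<le> t" "t \<le> T" for h t
      using r_bound[of h t] R[OF that] by simp
    obtain L where "0 \<le> L" and L: "\<And>h k t. norm h \<le> R \<Longrightarrow> norm k \<le> R \<Longrightarrow> 0 \<le> t \<Longrightarrow> t \<le> T \<Longrightarrow>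
        norm (\<Phi> h t - \<Phi> k t) \<le> L * norm (h - k)"
      using lipschitz_on_boundedE[OF lip, of R T] by blast
    have "norm (f h t - f k t) \<le> (L * 2) * norm (h - k)" if t: "0 \<le> t" "t \<le> T" for h k t
    proof -
      have "norm (f h t - f k t) \<le> L * norm (r h t - r k t)"
        unfolding f_def by (intro L rR t)
      also have "\<dots> \<le> L * (2 * norm (h - k))"
        by (intro mult_left_mono r_lip t \<open>0 \<le> L\<close>)
      finally show ?thesis by simp
    qed
    then show "\<exists>L. \<forall>h k t. 0 \<le> t \<longrightarrow> t \<le> T \<longrightarrow> norm (f h t - f k t) \<le> L * norm (h - k)"
      by blast
  qed
  then obtain z where z: "solves_cauchy f z\<^sub>0 z" by blast
  have cz: "continuous_on {0..} z"
    using z by (rule solves_cauchy_continuous)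
  define A where "A = (\<lambda>t. \<gamma> t - \<mu>' t / \<mu> t)"
  \<comment> \<open>The sign of \<open>A\<close> comes from the bound on \<open>\<beta>\<close>,
    since \<open>\<beta>\<close> is nonnegative.\<close>
  have A_nonneg: "0 \<le> A t" if "0 \<le> t" for t
  proof -
    have "0 \<le> \<beta> t"
      using \<beta>_eq[OF that] \<alpha>_nonneg[OF that] by simp
    also have "\<dots> \<le> 1 / (2 * \<mu> t) * A t"
      unfolding A_def by (rule \<beta>_le[OF that])
    finally have "0 \<le> 1 / (2 * \<mu> t) * A t" .
    then show ?thesis
      using \<mu>_pos[OF that] by (simp add: zero_le_divide_iff)
  qed
  have cA: "continuous_on {0..} A"
    unfolding A_def using \<mu>_ne by (auto intro!: continuous_intros \<gamma>_cont \<mu>'_cont c\<mu>)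
  define q where "q = (\<lambda>t. (\<mu> t)\<^sup>2 * inner (z t - x t) (z t - x t))"
  define q' where "q' = (\<lambda>t. 2 * \<mu> t * \<mu>' t * inner (z t - x t) (z t - x t) +
      (\<mu> t)\<^sup>2 * (2 * inner (z t - x t) (f (z t) t - x' t)))"
  have q_eq: "q t = (\<mu> t * norm (z t - x t))\<^sup>2" for t
    by (simp add: q_def power_mult_distrib dot_square_norm)
  have q_less_iff: "q t < 1 \<longleftrightarrow> \<mu> t * norm (z t - x t) < 1" if "0 \<le> t" for t
    using \<mu>_pos[OF that] by (simp add: q_eq abs_square_less_1 abs_mult)
  have "q t < 1" if "0 \<le> t" for t
  proof (rule less_one_if_derivative_bound[OF _ _ _ _ that])
    show "continuous_on {0..} q"
      unfolding q_def by (intro continuous_intros c\<mu> cz cx)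
    show "q 0 < 1"
      using q_less_iff[of 0] init z by (simp add: solves_cauchy_def)
    show "(q has_real_derivative q' t) (at t)" if "0 < t" for t
    proof -
      have "((\<lambda>t. z t - x t) has_vector_derivative f (z t) t - x' t) (at t)"
        using z x_deriv that unfolding solves_cauchy_def
        by (intro has_vector_derivative_diff has_vector_derivative_within_atLeast_imp_at) auto
      then have "((\<lambda>t. inner (z t - x t) (z t - x t)) has_real_derivative
          2 * inner (z t - x t) (f (z t) t - x' t)) (at t)"
        by (rule has_real_derivative_inner_self)
      moreover have "(\<mu> has_real_derivative \<mu>' t) (at t)"
        using \<mu>_deriv[of t] that at_within_interior[of t "{0..}"] by auto
      then have "((\<lambda>t. (\<mu> t)\<^sup>2) has_real_derivative 2 * \<mu> t * \<mu>' t) (at t)"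
        by (auto intro!: derivative_eq_intros)
      ultimately show ?thesis
        unfolding q_def q'_def by (intro DERIV_cong[OF DERIV_mult]) (assumption+, rule add_left_cancel[THEN iffD2, OF mult.commute])
    qed
    fix T
    obtain C where C: "\<And>t. 0 \<le> t \<Longrightarrow> t \<le> T \<Longrightarrow> norm (A t) \<le> C"
      using continuous_on_Icc_norm_bounded[OF cA] by blast
    have "q' t \<le> C * (1 - q t)" if t: "0 < t" "t < T" and "q t < 1" for t
    proof -
      define u where "u = norm (z t - x t)"
      define m where "m = \<mu> t"
      define v where "v = m * u"
      have t0: "0 \<le> t" using t by simp
      have m: "0 < m" using \<mu>_pos[OF t0] by (simp add: m_def)
      have u: "0 \<le> u" by (simp add: u_def)
      have v: "0 \<le> v" "v < 1"
        using m u \<open>q t < 1\<close> q_less_iff[OF t0] by (auto simp: v_def m_def u_def)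
      \<comment> \<open>Where \<open>q t < 1\<close> the truncation is inactive, so the estimate for
        \<open>\<Phi>\<close> along \<open>z\<close> applies to \<open>f\<close> as well.\<close>
      have f_eq: "f (z t) t = \<Phi> (z t) t"
        using v r_eq[OF t0] by (simp add: f_def v_def m_def u_def)
      have "inner (z t - x t) (f (z t) t - x' t) = inner (\<Phi> (z t) t) (z t - x t) - inner (z t - x t) (x' t)"
        by (simp add: f_eq inner_diff_right inner_commute)
      \<comment> \<open>Cauchy-Schwarz against \<open>- x' t\<close> yields the term
        \<open>u * norm (x' t)\<close>, which combines with \<open>\<alpha> t * u\<close> into
        \<open>\<beta> t * u\<close>.\<close>
      also have "\<dots> \<le> (\<alpha> t * u - \<gamma> t * u\<^sup>2 + \<sigma> t * u ^ 3) + u * norm (x' t)"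
        using \<Phi>_ineq[OF t0, of "z t"] norm_cauchy_schwarz[of "z t - x t" "- x' t"] by (simp add: u_def)
      also have "\<dots> = u * (\<beta> t - \<gamma> t * u + \<sigma> t * u\<^sup>2)"
        using \<beta>_eq[OF t0] by (simp add: algebra_simps power2_eq_square power3_eq_cube)
      finally have ip: "inner (z t - x t) (f (z t) t - x' t) \<le> u * (\<beta> t - \<gamma> t * u + \<sigma> t * u\<^sup>2)" .
      have "q' t \<le> 2 * m * \<mu>' t * u\<^sup>2 + m\<^sup>2 * (2 * (u * (\<beta> t - \<gamma> t * u + \<sigma> t * u\<^sup>2)))"
        unfolding q'_def m_def[symmetric] dot_square_norm u_def[symmetric]
        using ip by (intro add_left_mono mult_left_mono) auto
      also have "\<dots> = 2 * v * (m * \<beta> t - (m * \<gamma> t - \<mu>' t) * u + m * \<sigma> t * u\<^sup>2)"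
        by (simp add: v_def algebra_simps power2_eq_square)
      \<comment> \<open>The bound on \<open>\<beta>\<close>, the definition of \<open>A\<close> and
        the bound on \<open>\<sigma>\<close> give one coefficient each; together they form
        \<open>A t / 2\<close> times the square of \<open>1 - v\<close>.\<close>
      also have "\<dots> \<le> 2 * v * (A t / 2 - A t * v + A t / 2 * v\<^sup>2)"
      proof -
        have "m * \<beta> t \<le> A t / 2"
          using \<beta>_le[OF t0] m by (simp add: A_def m_def field_simps)
        moreover have "(m * \<gamma> t - \<mu>' t) * u = A t * v"
          using m by (simp add: A_def m_def v_def field_simps)
        moreover have "m * \<sigma> t * u\<^sup>2 \<le> A t / 2 * v\<^sup>2"
        proof -
          have "m * \<sigma> t * u\<^sup>2 \<le> m * (m / 2 * A t) * u\<^sup>2"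
            using \<sigma>_le[OF t0] m by (intro mult_right_mono mult_left_mono) (auto simp: A_def m_def)
          then show ?thesis by (simp add: v_def power2_eq_square algebra_simps)
        qed
        ultimately show ?thesis
          using v by (intro mult_left_mono) auto
      qed
      also have "\<dots> = A t * ((1 - v) * (v * (1 - v)))"
        by (simp add: algebra_simps power2_eq_square)
      \<comment> \<open>One of the two factors \<open>1 - v\<close> is given up to reach
        \<open>1 - q t\<close>, which makes the inequality linear.\<close>
      also have "\<dots> \<le> A t * ((1 - v) * (1 + v))"
      proof (intro mult_left_mono A_nonneg t0)
        have "0 \<le> v * v" by simp
        then show "v * (1 - v) \<le> 1 + v" by (simp add: algebra_simps)
      qed (use v in auto)
      also have "(1 - v) * (1 + v) = 1 - q t"
        by (simp add: q_eq v_def m_def u_def algebra_simps power2_eq_square)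
      also have "A t * (1 - q t) \<le> C * (1 - q t)"
        using C[of t] t \<open>q t < 1\<close> by (intro mult_right_mono) auto
      finally show ?thesis .
    qed
    then show "\<exists>C. \<forall>t. 0 < t \<longrightarrow> t < T \<longrightarrow> q t < 1 \<longrightarrow> q' t \<le> C * (1 - q t)"
      by blast
  qed
  then have less: "\<mu> t * norm (z t - x t) < 1" if "0 \<le> t" for t
    using q_less_iff that by blast
  then have bound: "norm (z t - x t) < 1 / \<mu> t" if "0 \<le> t" for t
    using \<mu>_pos[OF that] less[OF that] by (simp add: field_simps)
  have sol: "solves_cauchy \<Phi> z\<^sub>0 z"
    using z less unfolding solves_cauchy_def f_def by (simp add: r_eq less_imp_le)
  \<comment> \<open>The competitor \<open>w\<close> is not assumed to stay in the tube: uniqueness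
    uses the Lipschitz bounds of \<open>\<Phi>\<close> itself, not those of the truncated
    \<open>f\<close>.\<close>
  moreover have "w t = z t" if "solves_cauchy \<Phi> z\<^sub>0 w" "0 \<le> t" for w t
    using solves_cauchy_unique[OF lip that(1) sol that(2)] .
  moreover have "((\<lambda>t. norm (z t - x t)) \<longlongrightarrow> 0) at_top"
  proof (rule tendsto_sandwich[where f = "\<lambda>_. 0"])
    show "((\<lambda>t. 1 / \<mu> t) \<longlongrightarrow> 0) at_top"
      using tendsto_inverse_0_at_top[OF \<mu>_lim] by (simp add: inverse_eq_divide)
    show "eventually (\<lambda>t. norm (z t - x t) \<le> 1 / \<mu> t) at_top"
      using eventually_ge_at_top[of 0] by eventually_elim (use bound in \<open>auto intro: less_imp_le\<close>)
  qed auto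
  ultimately show ?thesis
    using bound by blast
qed

end
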